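(* Let $0<p_i<1$ for $1\le i\le d$, and $|p|<1$. For $\nu\in\mathbb{N}_0^d$ with $|\nu|\le N$, the polynomials $$K_\nu(x;p,N)=\frac{(-1)^{|\nu|}}{(-N)_{|\nu|}}\prod_{j=1}^d\frac{p_j^{\nu_j}}{(1-p_1-\cdots-p_j)^{\nu_j}}(-N+|X_{j-1}|+|\nu^{j+1}|)_{\nu_j}\,K_{\nu_j}\Big(x_j;\tfrac{p_j}{1-p_1-\cdots-p_{j-1}},N-|X_{j-1}|-|\nu^{j+1}|\Big)$$ satisfy the difference equation $DK_\nu=\lambda_{|\nu|}K_\nu$, where $\lambda_n=-n$ and $$D=\sum_{1\le i,j\le d}(\delta_{i,j}-p_i)x_j\triangle_i\nabla_j+\sum_{i=1}^d(p_iN-x_i)\triangle_i,$$ and, for $|\nu|,|\mu|\le N$, the orthogonality relation $$\sum_{x\in\mathbb{N}_0^d,\ |x|\le N}K_\nu(x;p,N)K_\mu(x;p,N)\prod_{i=1}^{d+1}\frac{p_i^{x_i}}{x_i!}=\frac{(-1)^{|\nu|}}{(-N)_{|\nu|}N!}\prod_{j=1}^d\frac{\nu_j!\,p_j^{\nu_j}}{(1-p_1-\cdots-p_j)^{\nu_j-\nu_{j+1}}}\,\delta_{\nu,\mu},$$ where $x_{d+1}=N-|x|$, $p_{d+1}=1-|p|$ and $\nu_{d+1}=0$.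
   Context: $d>1$, $N\in\mathbb{N}_0$; $\triangle_if(x)=f(x+e_i)-f(x)$, $\nabla_if(x)=f(x)-f(x-e_i)$; $(y)_k=y(y+1)\cdots(y+k-1)$, $(y)_0=1$. $x=(x_1,\dots,x_d)$, $p=(p_1,\dots,p_d)$; $|x|$, $|p|$, $|\nu|$ denote sums of the $d$ coordinates; $|\nu^{j+1}|=\nu_{j+1}+\dots+\nu_d$ (zero for $j=d$), $|X_{j-1}|=x_1+\dots+x_{j-1}$ (zero for $j=1$). Krawtchouk polynomials in one variable: $K_n(x;q,M)=\sum_{k=0}^n\frac{(-n)_k(-x)_k}{(-M)_k\,k!}q^{-k}$; the products $(-M)_nK_n(x;q,M)$ are understood as polynomials in $M$ and $x$, i.e. with $(-M)_n/(-M)_k=(-M+k)_{n-k}$. *)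

theory Defs
  imports Complex_Main
begin

text \<open>
  A vector with coordinates 1, ..., d is a function on nat whose values at 1, ..., d are its
  coordinates. A d-tuple of natural numbers is normalised to vanish at all other indices, so that
  equality of functions is equality of tuples, sums over d-tuples count each one once, and
  nu_{d+1} = 0.
\<close>

definition multi_indices :: "nat \<Rightarrow> (nat \<Rightarrow> nat) set" where
  "multi_indices d = {\<nu>. \<forall>i. i \<notin> {1..d} \<longrightarrow> \<nu> i = 0}"

lemma finite_multi_indices_le: "finite {x \<in> multi_indices d. (\<Sum>i=1..d. x i) \<le> N}"
proof (rule finite_subset)
  show "{x \<in> multi_indices d. (\<Sum>i=1..d. x i) \<le> N}
      \<subseteq> {x. \<forall>i. (i \<in> {1..d} \<longrightarrow> x i \<in> {..N}) \<and> (i \<notin> {1..d} \<longrightarrow> x i = 0)}"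
  proof (rule subsetI)
    fix x :: "nat \<Rightarrow> nat"
    assume x: "x \<in> {x \<in> multi_indices d. (\<Sum>i=1..d. x i) \<le> N}"
    have "x i \<le> N" if "i \<in> {1..d}" for i
      using member_le_sum[OF that, of x] x by simp
    then show "x \<in> {x. \<forall>i. (i \<in> {1..d} \<longrightarrow> x i \<in> {..N}) \<and> (i \<notin> {1..d} \<longrightarrow> x i = 0)}"
      using x by (simp add: multi_indices_def)
  qed
  show "finite {x. \<forall>i. (i \<in> {1..d} \<longrightarrow> x i \<in> {..N}) \<and> (i \<notin> {1..d} \<longrightarrow> x i = (0::nat))}"
    by (rule finite_set_of_finite_funs) simp_all
qed

definition forward_diff :: "nat \<Rightarrow> ((nat \<Rightarrow> real) \<Rightarrow> real) \<Rightarrow> (nat \<Rightarrow> real) \<Rightarrow> real" where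
  "forward_diff i f x = f (x(i := x i + 1)) - f x"

definition backward_diff :: "nat \<Rightarrow> ((nat \<Rightarrow> real) \<Rightarrow> real) \<Rightarrow> (nat \<Rightarrow> real) \<Rightarrow> real" where
  "backward_diff i f x = f x - f (x(i := x i - 1))"

definition krawtchouk :: "nat \<Rightarrow> real \<Rightarrow> real \<Rightarrow> real \<Rightarrow> real" where
  "krawtchouk n x q M =
     (\<Sum>k=0..n. pochhammer (- real n) k * pochhammer (- x) k / (pochhammer (- M) k * fact k) / q ^ k)"

text \<open>
  The product (-M)_n K_n(x; q, M), understood as a polynomial in M and x: the quotient
  (-M)_n / (-M)_k is replaced by (-M + k)_{n-k}. The two readings differ when (-M)_n = 0, where
  \<open>krawtchouk\<close> may divide by zero.
\<close>

definition krawtchouk_mult :: "nat \<Rightarrow> real \<Rightarrow> real \<Rightarrow> real \<Rightarrow> real" where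
  "krawtchouk_mult n x q M =
     (\<Sum>k=0..n. pochhammer (- real n) k * pochhammer (- x) k * pochhammer (- M + real k) (n - k)
                / fact k / q ^ k)"

lemma krawtchouk_mult_eq:
  assumes "pochhammer (- M) n \<noteq> 0"
  shows "krawtchouk_mult n x q M = pochhammer (- M) n * krawtchouk n x q M"
  unfolding krawtchouk_mult_def krawtchouk_def sum_distrib_left
proof (rule sum.cong[OF refl])
  fix k assume "k \<in> {0..n}"
  then have split: "pochhammer (- M) n = pochhammer (- M) k * pochhammer (- M + real k) (n - k)"
    by (intro pochhammer_product) auto
  then have "pochhammer (- M) k \<noteq> 0" using assms by auto
  then show "pochhammer (- real n) k * pochhammer (- x) k * pochhammer (- M + real k) (n - k)
                / fact k / q ^ k =
             pochhammer (- M) n * (pochhammer (- real n) k * pochhammer (- x) k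
                / (pochhammer (- M) k * fact k) / q ^ k)"
    unfolding split by simp
qed

text \<open>
  With M = N - |X_{j-1}| - |nu^{j+1}|, the factor (-N + |X_{j-1}| + |nu^{j+1}|)_{nu_j} is
  (-M)_{nu_j}; it is contained in \<open>krawtchouk_mult\<close>.
\<close>

definition multi_krawtchouk ::
    "nat \<Rightarrow> (nat \<Rightarrow> nat) \<Rightarrow> (nat \<Rightarrow> real) \<Rightarrow> nat \<Rightarrow> (nat \<Rightarrow> real) \<Rightarrow> real" where
  "multi_krawtchouk d \<nu> p N x =
     (- 1) ^ (\<Sum>i=1..d. \<nu> i) / pochhammer (- real N) (\<Sum>i=1..d. \<nu> i) *
     (\<Prod>j=1..d. p j ^ \<nu> j / (1 - (\<Sum>i=1..j. p i)) ^ \<nu> j *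
        krawtchouk_mult (\<nu> j) (x j) (p j / (1 - (\<Sum>i=1..<j. p i)))
          (real N - (\<Sum>i=1..<j. x i) - real (\<Sum>i=j+1..d. \<nu> i)))"

definition krawtchouk_operator ::
    "nat \<Rightarrow> (nat \<Rightarrow> real) \<Rightarrow> nat \<Rightarrow> ((nat \<Rightarrow> real) \<Rightarrow> real) \<Rightarrow> (nat \<Rightarrow> real) \<Rightarrow> real" where
  "krawtchouk_operator d p N f x =
     (\<Sum>i=1..d. \<Sum>j=1..d.
        ((if i = j then 1 else 0) - p i) * x j * forward_diff i (backward_diff j f) x) +
     (\<Sum>i=1..d. (p i * real N - x i) * forward_diff i f x)"

end

theory Submission
  imports Defs
begin

text \<open>
  Read \<open>x\<^sub>1, \<dots>, x\<^sub>d\<close> and \<open>x\<^sub>d\<^sub>+\<^sub>1 = N - |x|\<close> as the occupation numbers of \<open>d + 1\<close> boxes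
  holding \<open>N\<close> balls, and put \<open>p\<^sub>d\<^sub>+\<^sub>1 = 1 - |p|\<close>. Expanding the differences shows that \<open>D f (x)\<close>
  is \<open>N\<close> times the expected change of \<open>f\<close> in a resampling step: draw a ball uniformly and put it
  back into box \<open>b\<close> with probability \<open>p\<^sub>b\<close>. That is, \<open>D = S T - N\<close>, where
  \<open>T f (x) = \<Sum>\<^sub>b p\<^sub>b f (x + e\<^sub>b)\<close> deposits a ball and \<open>S g (x) = \<Sum>\<^sub>a x\<^sub>a g (x - e\<^sub>a)\<close> removes one;
  here \<open>e\<^sub>d\<^sub>+\<^sub>1 = 0\<close>, because the last box is implicit in the total \<open>N\<close>.

  Let \<open>F\<^sub>N\<close> be the product in the definition of \<open>K\<^sub>\<nu>\<close> without its leading constant. The two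
  halves of the step change only the parameter \<open>N\<close>:
  \<open>T F\<^sub>N = F\<^sub>N\<^sub>-\<^sub>1\<close> (\<open>krawtchouk_prod_lower\<close>) and
  \<open>S F\<^sub>N\<^sub>-\<^sub>1 = (N - |\<nu>|) F\<^sub>N\<close> (\<open>krawtchouk_prod_raise\<close>).
  Together they give \<open>D F\<^sub>N = (N - |\<nu>|) F\<^sub>N - N F\<^sub>N = -|\<nu>| F\<^sub>N\<close>, for all real \<open>x\<close>. Both
  relations follow by induction on \<open>d\<close> from their one-variable cases, since splitting off the last
  coordinate leaves a product of the same kind with \<open>N\<close> replaced by \<open>N - \<nu>\<^sub>d\<close>.

  Orthogonality uses the same pair of relations in one variable, for the polynomials
  \<open>(-M)\<^sub>n K\<^sub>n(x; q, M)\<close> with \<open>q = a / (a + b)\<close>. With respect to the weights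
  \<open>a\<^sup>x b\<^sup>M\<^sup>-\<^sup>x / (x! (M - x)!)\<close>, deposit and removal are adjoint to each other
  (\<open>binomial_inner_adjoint\<close>). So the inner product \<open>I\<^sub>M\<close> of the \<open>n\<close>-th and the \<open>m\<close>-th polynomial
  satisfies \<open>(M - m) I\<^sub>M = (a + b) I\<^sub>M\<^sub>-\<^sub>1\<close> for \<open>M > 0\<close>, and by symmetry also
  \<open>(M - n) I\<^sub>M = (a + b) I\<^sub>M\<^sub>-\<^sub>1\<close>. For \<open>n \<noteq> m\<close> this forces \<open>I\<^sub>M = 0\<close>. For \<open>n = m\<close> it gives
  \<open>I\<^sub>M = 0\<close> when \<open>M < n\<close>, and when \<open>M \<ge> n\<close> it reduces everything to \<open>M = n\<close>, where the polynomial
  is \<open>(-1)\<^sup>n n! (1 - 1/q)\<^sup>x\<close> on the integers \<open>0, \<dots>, n\<close> and the binomial theorem applies. In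
  several variables, summing over the last coordinate first produces the factor for
  \<open>\<nu>\<^sub>d = \<mu>\<^sub>d\<close> and leaves the sum in \<open>d - 1\<close> variables with \<open>N - \<nu>\<^sub>d\<close> balls, in which the last
  two boxes are merged (\<open>krawtchouk_prod_orthogonal\<close>).
\<close>

section \<open>Contiguous relations for one-variable Krawtchouk polynomials\<close>

lemma pochhammer_plus_one_diff:
  "pochhammer (c + 1) (Suc n) - pochhammer c (Suc n) = real (Suc n) * pochhammer (c + 1 :: real) n"
  unfolding pochhammer_rec[of c] pochhammer_Suc[of "c + 1"] by (simp add: algebra_simps)

text \<open>
  Averaging over the box of an added ball: this is \<open>krawtchouk_prod_lower\<close> in one variable. The
  difference in \<open>x\<close> and the difference in \<open>M\<close> agree after a shift of the summation index by one.
\<close>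

lemma krawtchouk_mult_lower:
  assumes "q \<noteq> 0"
  shows "q * krawtchouk_mult n (x + 1) q M + (1 - q) * krawtchouk_mult n x q M
           = krawtchouk_mult n x q (M - 1)"
proof (cases n)
  case 0
  then show ?thesis by (simp add: krawtchouk_mult_def algebra_simps)
next
  case (Suc m)
  define a where "a k = pochhammer (- real n) k * pochhammer (- x) k *
      (pochhammer (- (M - 1) + real k) (n - k) - pochhammer (- M + real k) (n - k)) / fact k / q ^ k" for k
  define b where "b k = q * (pochhammer (- real n) k *
      (pochhammer (- (x + 1)) k - pochhammer (- x) k) * pochhammer (- M + real k) (n - k) / fact k / q ^ k)" for k
  have ab: "a k = b (Suc k)" if "k \<le> m" for k
  proof -
    have nk: "n - k = Suc (m - k)" "n - Suc k = m - k" using that Suc by auto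
    have A: "pochhammer (- (M - 1) + real k) (n - k) - pochhammer (- M + real k) (n - k)
        = (real n - real k) * pochhammer (- M + real k + 1) (m - k)"
      using pochhammer_plus_one_diff[of "- M + real k" "m - k"] nk that Suc
      by (simp add: algebra_simps)
    have B: "pochhammer (- (x + 1)) (Suc k) - pochhammer (- x) (Suc k) = - real (Suc k) * pochhammer (- x) k"
    proof -
      have "- (x + 1) + 1 = - x" by simp
      then show ?thesis
        using pochhammer_plus_one_diff[of "- (x + 1)" k] by (simp only:)
    qed
    have C: "pochhammer (- M + real (Suc k)) (n - Suc k) = pochhammer (- M + real k + 1) (m - k)"
      using nk by (simp add: algebra_simps)
    show ?thesis
      unfolding a_def b_def A B C pochhammer_Suc[of "- real n" k] fact_Suc power_Suc
      using assms by (simp add: divide_simps) (simp add: algebra_simps)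
  qed
  have "krawtchouk_mult n x q (M - 1) - krawtchouk_mult n x q M = (\<Sum>k=0..Suc m. a k)"
    unfolding krawtchouk_mult_def a_def sum_subtractf[symmetric] Suc
    by (intro sum.cong refl) (simp add: diff_divide_distrib right_diff_distrib)
  also have "\<dots> = (\<Sum>k=0..m. a k)"
    by (simp add: a_def Suc)
  also have "\<dots> = (\<Sum>k=0..m. b (Suc k))"
    by (intro sum.cong refl ab) auto
  also have "\<dots> = (\<Sum>k=0..Suc m. b k)"
    by (simp add: sum.atLeast0_atMost_Suc_shift b_def del: sum.cl_ivl_Suc)
  also have "\<dots> = q * (krawtchouk_mult n (x + 1) q M - krawtchouk_mult n x q M)"
    unfolding krawtchouk_mult_def b_def sum_subtractf[symmetric] Suc sum_distrib_left
    by (intro sum.cong refl) (simp add: diff_divide_distrib right_diff_distrib left_diff_distrib)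
  finally show ?thesis by (simp add: algebra_simps)
qed

text \<open>
  Summing over the removed ball: this is \<open>krawtchouk_prod_raise\<close> in one variable. It holds term by
  term in the defining sum, for every \<open>q\<close>.
\<close>

lemma krawtchouk_mult_raise:
  "x * krawtchouk_mult n (x - 1) q (M - 1) + (M - x) * krawtchouk_mult n x q (M - 1)
     = (M - real n) * krawtchouk_mult n x q M"
proof -
  have term_eq: "x * (pochhammer (- (x - 1)) k * pochhammer (- (M - 1) + real k) (n - k)) +
      (M - x) * (pochhammer (- x) k * pochhammer (- (M - 1) + real k) (n - k))
      = (M - real n) * (pochhammer (- x) k * pochhammer (- M + real k) (n - k))" (is "?l = ?r")
    if "k \<le> n" for k
  proof -
    have A: "x * pochhammer (- (x - 1)) k = (x - real k) * pochhammer (- x) k"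
      using pochhammer_rec[of "- x" k] pochhammer_Suc[of "- x" k] by (simp add: algebra_simps)
    have B: "(M - real k) * pochhammer (- (M - 1) + real k) (n - k)
        = (M - real n) * pochhammer (- M + real k) (n - k)"
      using pochhammer_rec[of "- M + real k" "n - k"] pochhammer_Suc[of "- M + real k" "n - k"] that
      by (simp add: algebra_simps)
    have "?l = pochhammer (- x) k * ((M - real k) * pochhammer (- (M - 1) + real k) (n - k))"
      unfolding mult.assoc[symmetric] A by (simp add: algebra_simps)
    also have "\<dots> = ?r" unfolding B by simp
    finally show ?thesis .
  qed
  show ?thesis
    unfolding krawtchouk_mult_def sum_distrib_left sum.distrib[symmetric]
  proof (intro sum.cong refl)
    fix k assume "k \<in> {0..n}"
    then show "x * (pochhammer (- real n) k * pochhammer (- (x - 1)) k *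
            pochhammer (- (M - 1) + real k) (n - k) / fact k / q ^ k) +
          (M - x) * (pochhammer (- real n) k * pochhammer (- x) k *
            pochhammer (- (M - 1) + real k) (n - k) / fact k / q ^ k) =
          (M - real n) * (pochhammer (- real n) k * pochhammer (- x) k *
            pochhammer (- M + real k) (n - k) / fact k / q ^ k)"
      using arg_cong[OF term_eq[of k], of "\<lambda>y. pochhammer (- real n) k / fact k / q ^ k * y"]
      by (simp add: distrib_left mult_ac)
  qed
qed

lemma krawtchouk_mult_diagonal:
  assumes "x \<le> n"
  shows "krawtchouk_mult n (real x) q (real n) = (- 1) ^ n * fact n * (1 - 1 / q) ^ x"
proof -
  have term_eq: "pochhammer (- real n) k * pochhammer (- real x) k * pochhammer (- real n + real k) (n - k)
                / fact k / q ^ k = (- 1) ^ n * fact n * (real (x choose k) * (- 1 / q) ^ k)"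
    if "k \<le> n" for k
  proof -
    have A: "pochhammer (- real n) k * pochhammer (- real n + real k) (n - k) = (- 1) ^ n * fact n"
      using pochhammer_product[OF that, of "- real n"] pochhammer_same[of n, where ?'a=real] by simp
    have B: "pochhammer (- real x) k / fact k = (- 1) ^ k * real (x choose k)"
      by (simp add: binomial_gbinomial gbinomial_pochhammer)
    have "pochhammer (- real n) k * pochhammer (- real x) k * pochhammer (- real n + real k) (n - k)
                / fact k / q ^ k
        = (pochhammer (- real n) k * pochhammer (- real n + real k) (n - k))
            * (pochhammer (- real x) k / fact k) / q ^ k"
      by (simp add: mult_ac)
    also have "\<dots> = (- 1) ^ n * fact n * (real (x choose k) * (- 1 / q) ^ k)"
      unfolding A B power_divide by simp
    finally show ?thesis .
  qed
  have "krawtchouk_mult n (real x) q (real n)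
      = (\<Sum>k=0..n. (- 1) ^ n * fact n * (real (x choose k) * (- 1 / q) ^ k))"
    unfolding krawtchouk_mult_def by (intro sum.cong refl term_eq) auto
  also have "\<dots> = (- 1) ^ n * fact n * (\<Sum>k=0..n. real (x choose k) * (- 1 / q) ^ k)"
    by (simp add: sum_distrib_left)
  also have "(\<Sum>k=0..n. real (x choose k) * (- 1 / q) ^ k) = (\<Sum>k\<le>x. real (x choose k) * (- 1 / q) ^ k)"
    by (rule sum.mono_neutral_right) (use assms in \<open>auto simp: binomial_eq_0\<close>)
  also have "\<dots> = (1 - 1 / q) ^ x"
    using binomial_ring[of "- 1 / q" 1 x] by (simp add: mult_ac)
  finally show ?thesis .
qed

section \<open>Orthogonality in one variable\<close>

text \<open>
  The inner product of functions on \<open>{0..M}\<close> for the unnormalised binomial weight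
  \<open>a\<^sup>x b\<^sup>M\<^sup>-\<^sup>x / (x! (M - x)!)\<close>. The sum \<open>a + b\<close> is not required to be \<open>1\<close>, because conditioning on
  the first coordinates of a multinomial weight leaves a smaller total.
\<close>

definition binomial_inner :: "nat \<Rightarrow> real \<Rightarrow> real \<Rightarrow> (nat \<Rightarrow> real) \<Rightarrow> (nat \<Rightarrow> real) \<Rightarrow> real" where
  "binomial_inner M a b f g = (\<Sum>x\<le>M. a ^ x / fact x * (b ^ (M - x) / fact (M - x)) * f x * g x)"

lemma binomial_inner_commute: "binomial_inner M a b f g = binomial_inner M a b g f"
  unfolding binomial_inner_def by (simp add: mult_ac)

text \<open>
  The index \<open>x - 1\<close> is truncated at \<open>x = 0\<close>, and \<open>g x\<close> is arbitrary at \<open>x = Suc M\<close>; both values are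
  multiplied by \<open>0\<close>.
\<close>

lemma binomial_inner_adjoint:
  "binomial_inner (Suc M) a b f (\<lambda>x. real x * g (x - 1) + real (Suc M - x) * g x)
     = binomial_inner M a b (\<lambda>x. a * f (Suc x) + b * f x) g"
proof -
  define w where "w x = a ^ x / fact x * (b ^ (Suc M - x) / fact (Suc M - x))" for x
  have "(\<Sum>x\<le>Suc M. w x * f x * (real x * g (x - 1)))
      = (\<Sum>x\<le>M. a ^ x / fact x * (b ^ (M - x) / fact (M - x)) * (a * f (Suc x)) * g x)"
    unfolding sum.atMost_Suc_shift
    by (auto simp: w_def field_simps intro!: sum.cong simp del: of_nat_Suc)
  moreover have "(\<Sum>x\<le>Suc M. w x * f x * (real (Suc M - x) * g x))
      = (\<Sum>x\<le>M. a ^ x / fact x * (b ^ (M - x) / fact (M - x)) * (b * f x) * g x)"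
    unfolding sum.atMost_Suc
    by (auto simp: w_def Suc_diff_le field_simps intro!: sum.cong simp del: of_nat_Suc)
  ultimately show ?thesis
    unfolding binomial_inner_def w_def[symmetric] sum.distrib[symmetric]
    by (simp add: distrib_left distrib_right sum.distrib)
qed

text \<open>
  The recurrence in \<open>M\<close> that determines all inner products: apply \<open>krawtchouk_mult_raise\<close> to the
  second argument, move the removal operator to the first one, and apply \<open>krawtchouk_mult_lower\<close>.
\<close>

lemma binomial_inner_krawtchouk_Suc:
  fixes a b :: real
  assumes "a > 0" "b > 0"
  defines "q \<equiv> a / (a + b)"
  shows "(real (Suc M) - real m) * binomial_inner (Suc M) a b
           (\<lambda>x. krawtchouk_mult n x q (Suc M)) (\<lambda>x. krawtchouk_mult m x q (Suc M))
       = (a + b) * binomial_inner M a b (\<lambda>x. krawtchouk_mult n x q M) (\<lambda>x. krawtchouk_mult m x q M)"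
proof -
  have raise: "(real (Suc M) - real m) * krawtchouk_mult m (real x) q (Suc M)
      = real x * krawtchouk_mult m (real (x - 1)) q M + real (Suc M - x) * krawtchouk_mult m (real x) q M"
    if "x \<le> Suc M" for x
    using krawtchouk_mult_raise[of "real x" m q "real (Suc M)"] that
    by (cases x) simp_all
  have lower: "a * krawtchouk_mult n (real (Suc x)) q (Suc M) + b * krawtchouk_mult n (real x) q (Suc M)
      = (a + b) * krawtchouk_mult n (real x) q M" for x
  proof -
    have "q \<noteq> 0" "(a + b) * q = a" "(a + b) * (1 - q) = b"
      using assms by (auto simp: field_simps add_nonneg_eq_0_iff)
    then show ?thesis
      using arg_cong[OF krawtchouk_mult_lower[of q n "real x" "real (Suc M)"], of "(*) (a + b)"]
      by (simp add: distrib_left mult.assoc[symmetric] add.commute[of 1])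
  qed
  have "(real (Suc M) - real m) * binomial_inner (Suc M) a b
           (\<lambda>x. krawtchouk_mult n x q (Suc M)) (\<lambda>x. krawtchouk_mult m x q (Suc M))
      = binomial_inner (Suc M) a b (\<lambda>x. krawtchouk_mult n x q (Suc M))
          (\<lambda>x. (real (Suc M) - real m) * krawtchouk_mult m x q (Suc M))"
    by (simp add: binomial_inner_def sum_distrib_left mult_ac del: sum.atMost_Suc)
  also have "\<dots> = binomial_inner (Suc M) a b (\<lambda>x. krawtchouk_mult n x q (Suc M))
      (\<lambda>x. real x * krawtchouk_mult m (real (x - 1)) q M + real (Suc M - x) * krawtchouk_mult m (real x) q M)"
    unfolding binomial_inner_def by (intro sum.cong refl) (simp only: raise atMost_iff)
  also have "\<dots> = binomial_inner M a b (\<lambda>x. (a + b) * krawtchouk_mult n (real x) q M)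
                    (\<lambda>x. krawtchouk_mult m (real x) q M)"
    using binomial_inner_adjoint[of M a b "\<lambda>x. krawtchouk_mult n x q (Suc M)"
        "\<lambda>x. krawtchouk_mult m x q M"]
    by (simp only: lower)
  also have "\<dots> = (a + b) * binomial_inner M a b (\<lambda>x. krawtchouk_mult n x q M) (\<lambda>x. krawtchouk_mult m x q M)"
    by (simp add: binomial_inner_def sum_distrib_left mult_ac)
  finally show ?thesis .
qed


lemma krawtchouk_mult_at_zero: "krawtchouk_mult n 0 q M = pochhammer (- M) n"
proof -
  have "krawtchouk_mult n 0 q M = (\<Sum>k=0..n. if k = 0 then pochhammer (- M) n else 0)"
    unfolding krawtchouk_mult_def by (intro sum.cong refl) (auto simp: pochhammer_0_left)
  then show ?thesis by simp
qed

lemma binomial_inner_krawtchouk_neq: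
  assumes "a > 0" "b > 0" "n \<noteq> m"
  shows "binomial_inner M a b (\<lambda>x. krawtchouk_mult n x (a / (a + b)) M)
           (\<lambda>x. krawtchouk_mult m x (a / (a + b)) M) = 0"
proof (cases M)
  case 0
  then show ?thesis
    using assms(3) by (auto simp: binomial_inner_def krawtchouk_mult_at_zero pochhammer_0_left)
next
  case (Suc M')
  let ?I = "binomial_inner M a b (\<lambda>x. krawtchouk_mult n x (a / (a + b)) M)
           (\<lambda>x. krawtchouk_mult m x (a / (a + b)) M)"
  \<comment> \<open>By symmetry of the inner product, both sides equal the same multiple of the one for \<open>M'\<close>.\<close>
  have "(real M - real m) * ?I = (real M - real n) * ?I"
    using binomial_inner_krawtchouk_Suc[OF assms(1,2), of M' m n]
      binomial_inner_krawtchouk_Suc[OF assms(1,2), of M' n m]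
    unfolding Suc by (simp only: binomial_inner_commute)
  then show ?thesis using assms(3) by simp
qed

lemma binomial_inner_krawtchouk_low:
  assumes "a > 0" "b > 0" "M < n"
  shows "binomial_inner M a b (\<lambda>x. krawtchouk_mult n x (a / (a + b)) M)
           (\<lambda>x. krawtchouk_mult n x (a / (a + b)) M) = 0"
  using assms(3)
proof (induction M)
  case 0
  then show ?case by (auto simp: binomial_inner_def krawtchouk_mult_at_zero pochhammer_0_left)
next
  case (Suc M)
  then show ?case
    using binomial_inner_krawtchouk_Suc[OF assms(1,2), of M n n] by simp
qed

lemma binomial_inner_krawtchouk_diagonal:
  assumes "a > 0" "b > 0"
  shows "binomial_inner n a b (\<lambda>x. krawtchouk_mult n x (a / (a + b)) n)
           (\<lambda>x. krawtchouk_mult n x (a / (a + b)) n) = fact n * (b * (a + b) / a) ^ n"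
proof -
  have term_eq: "a ^ x / fact x * (b ^ (n - x) / fact (n - x)) * krawtchouk_mult n x (a / (a + b)) n
        * krawtchouk_mult n x (a / (a + b)) n
      = fact n * (real (n choose x) * (b\<^sup>2 / a) ^ x * b ^ (n - x))" if "x \<le> n" for x
  proof -
    have q: "1 - 1 / (a / (a + b)) = - (b / a)" using assms by (simp add: field_simps)
    have sq: "(- 1) ^ k * ((- 1) ^ k * z) = (z::real)" for k z
      unfolding mult.assoc[symmetric] power_add[symmetric] by simp
    have pw: "a ^ x * ((- (b / a)) ^ x * (- (b / a)) ^ x) = (b\<^sup>2 / a) ^ x"
      unfolding power_mult_distrib[symmetric] using assms by (simp add: power2_eq_square field_simps)
    have "a ^ x / fact x * (b ^ (n - x) / fact (n - x)) * krawtchouk_mult n x (a / (a + b)) n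
        * krawtchouk_mult n x (a / (a + b)) n
        = fact n * fact n / (fact x * fact (n - x)) *
           (a ^ x * ((- (b / a)) ^ x * (- (b / a)) ^ x)) * b ^ (n - x)"
      unfolding krawtchouk_mult_diagonal[OF that] q by (simp add: sq mult_ac)
    then show ?thesis unfolding pw using that by (simp add: binomial_fact)
  qed
  have "binomial_inner n a b (\<lambda>x. krawtchouk_mult n x (a / (a + b)) n)
           (\<lambda>x. krawtchouk_mult n x (a / (a + b)) n)
       = (\<Sum>x\<le>n. fact n * (real (n choose x) * (b\<^sup>2 / a) ^ x * b ^ (n - x)))"
    unfolding binomial_inner_def by (intro sum.cong refl term_eq) simp
  also have "\<dots> = fact n * (b\<^sup>2 / a + b) ^ n"
    unfolding binomial_ring sum_distrib_left ..
  also have "b\<^sup>2 / a + b = b * (a + b) / a"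
    using assms by (simp add: field_simps power2_eq_square)
  finally show ?thesis .
qed

lemma binomial_inner_krawtchouk:
  assumes "a > 0" "b > 0"
  shows "binomial_inner M a b (\<lambda>x. krawtchouk_mult n x (a / (a + b)) M)
           (\<lambda>x. krawtchouk_mult m x (a / (a + b)) M)
       = (if n = m \<and> n \<le> M
          then fact n * (b * (a + b) / a) ^ n * (a + b) ^ (M - n) / fact (M - n) else 0)"
proof -
  have "binomial_inner M a b (\<lambda>x. krawtchouk_mult n x (a / (a + b)) M)
           (\<lambda>x. krawtchouk_mult n x (a / (a + b)) M)
       = fact n * (b * (a + b) / a) ^ n * (a + b) ^ (M - n) / fact (M - n)" if "n \<le> M"
    using that
  proof (induction M rule: dec_induct)
    case base
    show ?case using binomial_inner_krawtchouk_diagonal[OF assms] by simp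
  next
    case (step M)
    let ?I = "binomial_inner (Suc M) a b (\<lambda>x. krawtchouk_mult n x (a / (a + b)) (Suc M))
           (\<lambda>x. krawtchouk_mult n x (a / (a + b)) (Suc M))"
    have dist: "Suc M - n = Suc (M - n)" "real (Suc M) - real n = real (Suc (M - n))"
      using step by (auto simp: Suc_diff_le)
    have "?I * real (Suc (M - n))
        = (a + b) * (fact n * (b * (a + b) / a) ^ n * (a + b) ^ (M - n) / fact (M - n))"
      using binomial_inner_krawtchouk_Suc[OF assms, of M n n] step.IH unfolding dist
      by (simp only: mult.commute[of ?I])
    then have "?I = (a + b) * (fact n * (b * (a + b) / a) ^ n * (a + b) ^ (M - n) / fact (M - n))
        / real (Suc (M - n))"
      by (intro eq_divide_imp) simp_all
    then show ?case
      unfolding dist(1) fact_Suc power_Suc by (simp add: mult_ac del: of_nat_Suc)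
  qed
  then show ?thesis
    using binomial_inner_krawtchouk_neq[OF assms] binomial_inner_krawtchouk_low[OF assms]
    by (cases "n = m"; cases "n \<le> M") (simp_all add: not_le)
qed

section \<open>Contiguous relations for the product\<close>

text \<open>
  The polynomial \<open>K\<^sub>\<nu>\<close> without the constant \<open>(-1)\<^sup>|\<^sup>\<nu>\<^sup>| / (-N)\<^sub>|\<^sub>\<nu>\<^sub>|\<close>. The parameter \<open>N\<close> is real, so that it
  can be shifted without restriction; only the values of \<open>\<nu>\<close>, \<open>p\<close> and \<open>x\<close> on \<open>{1..d}\<close> matter.
\<close>

definition krawtchouk_prod ::
    "nat \<Rightarrow> (nat \<Rightarrow> nat) \<Rightarrow> (nat \<Rightarrow> real) \<Rightarrow> real \<Rightarrow> (nat \<Rightarrow> real) \<Rightarrow> real" where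
  "krawtchouk_prod d \<nu> p N x =
     (\<Prod>j=1..d. p j ^ \<nu> j / (1 - (\<Sum>i=1..j. p i)) ^ \<nu> j *
        krawtchouk_mult (\<nu> j) (x j) (p j / (1 - (\<Sum>i=1..<j. p i)))
          (N - (\<Sum>i=1..<j. x i) - real (\<Sum>i=j+1..d. \<nu> i)))"

lemma krawtchouk_prod_0: "krawtchouk_prod 0 \<nu> p N x = 1"
  by (simp add: krawtchouk_prod_def)

text \<open>
  The entry \<open>\<nu> (Suc d)\<close> occurs in the first \<open>d\<close> factors only through the tail sums of \<open>\<nu>\<close>, where it
  shifts \<open>N\<close>. The inductions on \<open>d\<close> for this product rest on it.
\<close>

lemma krawtchouk_prod_Suc:
  "krawtchouk_prod (Suc d) \<nu> p N x =
     krawtchouk_prod d \<nu> p (N - real (\<nu> (Suc d))) x *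
     ((p (Suc d) / (1 - (\<Sum>i=1..Suc d. p i))) ^ \<nu> (Suc d) *
      krawtchouk_mult (\<nu> (Suc d)) (x (Suc d)) (p (Suc d) / (1 - (\<Sum>i=1..d. p i)))
        (N - (\<Sum>i=1..d. x i)))"
proof -
  have tail: "N - S - real (\<Sum>i=j+1..Suc d. \<nu> i)
      = N - real (\<nu> (Suc d)) - S - real (\<Sum>i=j+1..d. \<nu> i)" if "j \<in> {1..d}" for j and S :: real
    using that by simp
  have "(\<Prod>j=1..d. p j ^ \<nu> j / (1 - (\<Sum>i=1..j. p i)) ^ \<nu> j *
        krawtchouk_mult (\<nu> j) (x j) (p j / (1 - (\<Sum>i=1..<j. p i)))
          (N - (\<Sum>i=1..<j. x i) - real (\<Sum>i=j+1..Suc d. \<nu> i)))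
      = krawtchouk_prod d \<nu> p (N - real (\<nu> (Suc d))) x"
    unfolding krawtchouk_prod_def by (intro prod.cong refl) (simp only: tail)
  then show ?thesis
    unfolding krawtchouk_prod_def[of "Suc d"] prod.cl_ivl_Suc
    by (simp add: atLeastLessThanSuc_atLeastAtMost power_divide del: sum.cl_ivl_Suc)
qed

lemma krawtchouk_prod_cong:
  assumes "\<And>i. i \<in> {1..d} \<Longrightarrow> x i = y i"
  shows "krawtchouk_prod d \<nu> p N x = krawtchouk_prod d \<nu> p N y"
proof -
  have "(\<Sum>i=1..<j. x i) = (\<Sum>i=1..<j. y i)" if "j \<in> {1..d}" for j
    using that assms by (intro sum.cong) auto
  then show ?thesis
    unfolding krawtchouk_prod_def by (intro prod.cong refl) (simp add: assms)
qed

lemma krawtchouk_prod_upd_outside: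
  "d < i \<Longrightarrow> krawtchouk_prod d \<nu> p N (x(i := y)) = krawtchouk_prod d \<nu> p N x"
  by (rule krawtchouk_prod_cong) auto

lemma sum_fun_upd_real:
  "finite A \<Longrightarrow> i \<in> A \<Longrightarrow> (\<Sum>l\<in>A. (x(i := y)) l) = (\<Sum>l\<in>A. x l) - x i + (y::real)"
  by (simp add: sum.remove[of A i])

text \<open>
  Depositing a ball lowers \<open>N\<close> by one. In the induction step, box \<open>Suc d\<close> and the implicit last box
  together act like the implicit last box of the case \<open>d\<close>.
\<close>

lemma krawtchouk_prod_lower:
  fixes p x :: "nat \<Rightarrow> real"
  assumes "\<And>i. i \<in> {1..d} \<Longrightarrow> p i \<noteq> 0" "\<And>j. j < d \<Longrightarrow> (\<Sum>i=1..j. p i) \<noteq> 1"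
  shows "(\<Sum>b=1..d. p b * krawtchouk_prod d \<nu> p N (x(b := x b + 1)))
           + (1 - (\<Sum>i=1..d. p i)) * krawtchouk_prod d \<nu> p N x = krawtchouk_prod d \<nu> p (N - 1) x"
  using assms
proof (induction d arbitrary: N)
  case 0
  then show ?case by (simp add: krawtchouk_prod_0)
next
  case (Suc d)
  define n where "n = \<nu> (Suc d)"
  define P where "P = (\<Sum>i=1..d. p i)"
  define q where "q = p (Suc d) / (1 - P)"
  define c where "c = (p (Suc d) / (1 - (\<Sum>i=1..Suc d. p i))) ^ n"
  define M where "M = N - (\<Sum>i=1..d. x i)"
  define k where "k y L = krawtchouk_mult n y q L" for y L
  define F where "F y = krawtchouk_prod d \<nu> p (N - real n) y" for y
  have step: "krawtchouk_prod (Suc d) \<nu> p L y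
      = krawtchouk_prod d \<nu> p (L - real n) y * (c * k (y (Suc d)) (L - (\<Sum>i=1..d. y i)))" for L y
    unfolding krawtchouk_prod_Suc c_def k_def q_def P_def n_def ..
  have P: "1 - P \<noteq> 0" using Suc.prems(2)[of d] by (simp add: P_def)
  have q: "q \<noteq> 0" "(1 - P) * q = p (Suc d)" "(1 - P) * (1 - q) = 1 - P - p (Suc d)"
    using P Suc.prems(1)[of "Suc d"] by (auto simp: q_def field_simps)
  have inner: "p (Suc d) * k (x (Suc d) + 1) M + (1 - P - p (Suc d)) * k (x (Suc d)) M
      = (1 - P) * k (x (Suc d)) (M - 1)"
    unfolding k_def krawtchouk_mult_lower[OF q(1), symmetric] distrib_left mult.assoc[symmetric] q ..
  have IH: "(\<Sum>b=1..d. p b * F (x(b := x b + 1))) + (1 - P) * F x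
      = krawtchouk_prod d \<nu> p (N - real n - 1) x"
    unfolding F_def P_def using Suc.prems by (intro Suc.IH) auto
  \<comment> \<open>A ball in one of the first \<open>d\<close> boxes enters the last factor only through its \<open>M\<close>.\<close>
  have low: "krawtchouk_prod (Suc d) \<nu> p N (x(b := x b + 1))
      = F (x(b := x b + 1)) * (c * k (x (Suc d)) (M - 1))" if "b \<in> {1..d}" for b
  proof -
    have shift: "N - (\<Sum>i=1..d. (x(b := x b + 1)) i) = M - 1"
      using sum_fun_upd_real[of "{1..d}" b x "x b + 1"] that by (simp add: M_def)
    show ?thesis unfolding step shift F_def using that by simp
  qed
  have "(\<Sum>i=1..d. (x(Suc d := y)) i) = (\<Sum>i=1..d. x i)" for y
    by (intro sum.cong) auto
  then have last: "krawtchouk_prod (Suc d) \<nu> p N (x(Suc d := y)) = F x * (c * k y M)" for y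
    unfolding step by (simp add: krawtchouk_prod_upd_outside F_def M_def)
  have sum_Suc: "(\<Sum>i=1..Suc d. f i) = (\<Sum>i=1..d. f i) + f (Suc d)" for f :: "nat \<Rightarrow> real"
    by simp
  have sum_low: "(\<Sum>b=1..d. p b * krawtchouk_prod (Suc d) \<nu> p N (x(b := x b + 1)))
      = (\<Sum>b=1..d. p b * F (x(b := x b + 1))) * (c * k (x (Suc d)) (M - 1))"
    unfolding sum_distrib_right by (intro sum.cong refl) (simp only: low mult.assoc)
  have "(\<Sum>b=1..Suc d. p b * krawtchouk_prod (Suc d) \<nu> p N (x(b := x b + 1)))
           + (1 - (\<Sum>i=1..Suc d. p i)) * krawtchouk_prod (Suc d) \<nu> p N x
      = (\<Sum>b=1..d. p b * F (x(b := x b + 1))) * (c * k (x (Suc d)) (M - 1))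
         + F x * c * (p (Suc d) * k (x (Suc d) + 1) M + (1 - P - p (Suc d)) * k (x (Suc d)) M)"
    unfolding sum_Suc sum_low P_def[symmetric]
    using last[of "x (Suc d)"] last[of "x (Suc d) + 1"] by (simp add: algebra_simps)
  also have "\<dots> = ((\<Sum>b=1..d. p b * F (x(b := x b + 1))) + (1 - P) * F x) * (c * k (x (Suc d)) (M - 1))"
    unfolding inner by (simp add: algebra_simps)
  also have "\<dots> = krawtchouk_prod (Suc d) \<nu> p (N - 1) x"
    unfolding IH step M_def by (simp add: algebra_simps)
  finally show ?case .
qed

text \<open>
  Removing a ball raises \<open>N\<close> by one, at the cost of the factor \<open>N - |\<nu>|\<close>.
\<close>

lemma krawtchouk_prod_raise:
  fixes p x :: "nat \<Rightarrow> real"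
  shows "(\<Sum>a=1..d. x a * krawtchouk_prod d \<nu> p (N - 1) (x(a := x a - 1)))
           + (N - (\<Sum>i=1..d. x i)) * krawtchouk_prod d \<nu> p (N - 1) x
         = (N - real (\<Sum>i=1..d. \<nu> i)) * krawtchouk_prod d \<nu> p N x"
proof (induction d arbitrary: N)
  case 0
  then show ?case by (simp add: krawtchouk_prod_0)
next
  case (Suc d)
  define n where "n = \<nu> (Suc d)"
  define q where "q = p (Suc d) / (1 - (\<Sum>i=1..d. p i))"
  define c where "c = (p (Suc d) / (1 - (\<Sum>i=1..Suc d. p i))) ^ n"
  define X where "X = (\<Sum>i=1..d. x i)"
  define k where "k y L = krawtchouk_mult n y q L" for y L
  define F where "F y = krawtchouk_prod d \<nu> p (N - real n - 1) y" for y
  have step: "krawtchouk_prod (Suc d) \<nu> p L y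
      = krawtchouk_prod d \<nu> p (L - real n) y * (c * k (y (Suc d)) (L - (\<Sum>i=1..d. y i)))" for L y
    unfolding krawtchouk_prod_Suc c_def k_def q_def n_def ..
  have swap: "N - 1 - real n = N - real n - 1" by simp
  have inner: "x (Suc d) * k (x (Suc d) - 1) (N - X - 1) + (N - X - x (Suc d)) * k (x (Suc d)) (N - X - 1)
      = (N - X - real n) * k (x (Suc d)) (N - X)"
    unfolding k_def by (rule krawtchouk_mult_raise)
  have IH: "(\<Sum>a=1..d. x a * F (x(a := x a - 1))) + (N - real n - X) * F x
      = (N - real n - real (\<Sum>i=1..d. \<nu> i)) * krawtchouk_prod d \<nu> p (N - real n) x"
    unfolding F_def X_def by (rule Suc.IH)
  \<comment> \<open>In the last factor the lowered \<open>N\<close> and the lowered partial sum of \<open>x\<close> cancel.\<close>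
  have low: "krawtchouk_prod (Suc d) \<nu> p (N - 1) (x(a := x a - 1))
      = F (x(a := x a - 1)) * (c * k (x (Suc d)) (N - X))" if "a \<in> {1..d}" for a
  proof -
    have shift: "N - 1 - (\<Sum>i=1..d. (x(a := x a - 1)) i) = N - X"
      using sum_fun_upd_real[of "{1..d}" a x "x a - 1"] that by (simp add: X_def)
    show ?thesis unfolding step swap shift F_def using that by simp
  qed
  have "(\<Sum>i=1..d. (x(Suc d := y)) i) = (\<Sum>i=1..d. x i)" for y
    by (intro sum.cong) auto
  then have last: "krawtchouk_prod (Suc d) \<nu> p (N - 1) (x(Suc d := y)) = F x * (c * k y (N - X - 1))" for y
    unfolding step swap by (simp add: krawtchouk_prod_upd_outside F_def X_def algebra_simps)
  have sum_Suc: "(\<Sum>i=1..Suc d. f i) = (\<Sum>i=1..d. f i) + f (Suc d)" for f :: "nat \<Rightarrow> real"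
    by simp
  have sum_low: "(\<Sum>a=1..d. x a * krawtchouk_prod (Suc d) \<nu> p (N - 1) (x(a := x a - 1)))
      = (\<Sum>a=1..d. x a * F (x(a := x a - 1))) * (c * k (x (Suc d)) (N - X))"
    unfolding sum_distrib_right by (intro sum.cong refl) (simp only: low mult.assoc)
  have "(\<Sum>a=1..Suc d. x a * krawtchouk_prod (Suc d) \<nu> p (N - 1) (x(a := x a - 1)))
           + (N - (\<Sum>i=1..Suc d. x i)) * krawtchouk_prod (Suc d) \<nu> p (N - 1) x
      = (\<Sum>a=1..d. x a * F (x(a := x a - 1))) * (c * k (x (Suc d)) (N - X))
         + F x * c * (x (Suc d) * k (x (Suc d) - 1) (N - X - 1)
              + (N - X - x (Suc d)) * k (x (Suc d)) (N - X - 1))"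
    unfolding sum_Suc sum_low X_def[symmetric]
    using last[of "x (Suc d)"] last[of "x (Suc d) - 1"] by (simp add: algebra_simps)
  also have "\<dots> = ((\<Sum>a=1..d. x a * F (x(a := x a - 1))) + (N - real n - X) * F x)
       * (c * k (x (Suc d)) (N - X))"
    unfolding inner by (simp add: algebra_simps)
  also have "\<dots> = (N - real (\<Sum>i=1..Suc d. \<nu> i)) * krawtchouk_prod (Suc d) \<nu> p N x"
    unfolding IH unfolding step[of N] X_def by (simp add: n_def algebra_simps)
  finally show ?case .
qed

section \<open>The difference operator as a resampling step\<close>

text \<open>
  The average of \<open>f\<close> after a ball is added to box \<open>b\<close> with weight \<open>p\<^sub>b\<close>. Box \<open>d + 1\<close> has weight
  \<open>1 - |p|\<close> and is not a coordinate of \<open>x\<close>, so adding to it leaves \<open>x\<close> unchanged.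
\<close>

definition deposit :: "nat \<Rightarrow> (nat \<Rightarrow> real) \<Rightarrow> ((nat \<Rightarrow> real) \<Rightarrow> real) \<Rightarrow> (nat \<Rightarrow> real) \<Rightarrow> real" where
  "deposit d p f x = (\<Sum>b=1..d. p b * f (x(b := x b + 1))) + (1 - (\<Sum>i=1..d. p i)) * f x"

lemma krawtchouk_operator_eq_resampling:
  "krawtchouk_operator d p N f x =
     (\<Sum>j=1..d. x j * deposit d p f (x(j := x j - 1)))
       + (real N - (\<Sum>i=1..d. x i)) * deposit d p f x - real N * f x"
proof -
  define U where "U i = f (x(i := x i + 1))" for i
  define L where "L i = f (x(i := x i - 1))" for i
  define B where "B i j = f ((x(j := x j - 1))(i := (x(j := x j - 1)) i + 1))" for i j
  define P where "P = (\<Sum>i=1..d. p i)"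
  define A where "A = (\<Sum>i=1..d. p i * U i)"
  define R where "R j = (\<Sum>i=1..d. p i * B i j)" for j
  have second: "forward_diff i (backward_diff j f) x = U i - B i j - f x + L j" for i j
  proof -
    have "(x(i := x i + 1))(j := (x(i := x i + 1)) j - 1) = (x(j := x j - 1))(i := (x(j := x j - 1)) i + 1)"
      by (auto simp: fun_eq_iff)
    then show ?thesis by (simp add: forward_diff_def backward_diff_def U_def L_def B_def)
  qed
  \<comment> \<open>Moving a ball from a box into itself changes nothing. This evaluates the diagonal terms,
    the only ones in which the Kronecker delta is not zero.\<close>
  have diag: "B i i = f x" for i
    by (simp add: B_def)
  have dep: "deposit d p f (x(j := x j - 1)) = R j + (1 - P) * L j" for j
    by (simp add: deposit_def B_def L_def P_def R_def)
  have split: "(\<Sum>i=1..d. \<Sum>j=1..d. ((if i = j then 1 else 0) - p i) * x j * (U i - B i j - f x + L j))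
      = (\<Sum>j=1..d. x j * (U j - 2 * f x + L j))
        - (\<Sum>j=1..d. x j * (\<Sum>i=1..d. p i * (U i - B i j - f x + L j)))"
  proof -
    have "(\<Sum>i=1..d. \<Sum>j=1..d. ((if i = j then 1 else 0) - p i) * x j * (U i - B i j - f x + L j))
       = (\<Sum>j=1..d. \<Sum>i=1..d. ((if i = j then 1 else 0) - p i) * x j * (U i - B i j - f x + L j))"
      by (rule sum.swap)
    also have "\<dots> = (\<Sum>j=1..d. x j * (U j - 2 * f x + L j)
        - x j * (\<Sum>i=1..d. p i * (U i - B i j - f x + L j)))"
    proof (intro sum.cong refl)
      fix j assume j: "j \<in> {1..d}"
      have "(\<Sum>i=1..d. ((if i = j then 1 else 0) - p i) * x j * (U i - B i j - f x + L j))
          = (\<Sum>i=1..d. if i = j then x j * (U i - B i j - f x + L j) else 0)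
            - (\<Sum>i=1..d. p i * x j * (U i - B i j - f x + L j))"
        unfolding sum_subtractf[symmetric] by (intro sum.cong refl) (simp add: algebra_simps)
      also have "(\<Sum>i=1..d. if i = j then x j * (U i - B i j - f x + L j) else 0)
          = x j * (U j - 2 * f x + L j)"
        using j by (simp add: diag)
      finally show "(\<Sum>i=1..d. ((if i = j then 1 else 0) - p i) * x j * (U i - B i j - f x + L j))
          = x j * (U j - 2 * f x + L j) - x j * (\<Sum>i=1..d. p i * (U i - B i j - f x + L j))"
        by (simp add: sum_distrib_left mult_ac)
    qed
    finally show ?thesis by (simp add: sum_subtractf)
  qed
  have row: "(\<Sum>i=1..d. p i * (U i - B i j - f x + L j))
      = A - R j - P * f x + P * L j" for j
    by (simp add: P_def A_def R_def distrib_left right_diff_distrib sum.distrib sum_subtractf sum_distrib_right)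
  have drift: "(\<Sum>i=1..d. (p i * real N - x i) * (U i - f x))
      = real N * (A - P * f x) - (\<Sum>i=1..d. x i * (U i - f x))"
    by (simp add: P_def A_def algebra_simps sum.distrib sum_subtractf sum_distrib_left sum_distrib_right)
  show ?thesis
    unfolding krawtchouk_operator_def second dep split row
    unfolding forward_diff_def U_def[symmetric] drift
    unfolding deposit_def U_def[symmetric] P_def[symmetric] A_def[symmetric]
    by (simp add: algebra_simps sum.distrib sum_subtractf sum_distrib_left sum_distrib_right)
qed


lemma krawtchouk_operator_scale:
  "krawtchouk_operator d p N (\<lambda>x. c * f x) x = c * krawtchouk_operator d p N f x"
  unfolding krawtchouk_operator_eq_resampling deposit_def
  by (simp add: algebra_simps sum_distrib_left)

lemma krawtchouk_operator_prod:
  assumes "\<And>i. i \<in> {1..d} \<Longrightarrow> p i \<noteq> 0" "\<And>j. j < d \<Longrightarrow> (\<Sum>i=1..j. p i) \<noteq> 1"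
  shows "krawtchouk_operator d p N (krawtchouk_prod d \<nu> p N) x
           = - real (\<Sum>i=1..d. \<nu> i) * krawtchouk_prod d \<nu> p N x"
proof -
  have "deposit d p (krawtchouk_prod d \<nu> p N) y = krawtchouk_prod d \<nu> p (real N - 1) y" for y
    unfolding deposit_def using assms by (rule krawtchouk_prod_lower)
  then have "krawtchouk_operator d p N (krawtchouk_prod d \<nu> p N) x
      = (\<Sum>a=1..d. x a * krawtchouk_prod d \<nu> p (real N - 1) (x(a := x a - 1)))
        + (real N - (\<Sum>i=1..d. x i)) * krawtchouk_prod d \<nu> p (real N - 1) x
        - real N * krawtchouk_prod d \<nu> p N x"
    unfolding krawtchouk_operator_eq_resampling by simp
  then show ?thesis
    unfolding krawtchouk_prod_raise by (simp add: algebra_simps)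
qed

section \<open>Orthogonality in several variables\<close>

lemma sum_multi_indices_Suc:
  fixes g :: "(nat \<Rightarrow> nat) \<Rightarrow> real"
  shows "(\<Sum>x\<in>{x \<in> multi_indices (Suc d). (\<Sum>i=1..Suc d. x i) \<le> N}. g x)
    = (\<Sum>x\<in>{x \<in> multi_indices d. (\<Sum>i=1..d. x i) \<le> N}. \<Sum>k\<le>N - (\<Sum>i=1..d. x i). g (x(Suc d := k)))"
proof -
  let ?B = "{x \<in> multi_indices d. (\<Sum>i=1..d. x i) \<le> N}"
  have upd: "(\<Sum>i=1..d. (x(Suc d := k)) i) = (\<Sum>i=1..d. x i)" for x :: "nat \<Rightarrow> nat" and k
    by (intro sum.cong) auto
  have zero: "x(Suc d := 0) = x" if "x \<in> multi_indices d" for x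
    using that by (auto simp: multi_indices_def)
  have "(\<Sum>x\<in>?B. \<Sum>k\<le>N - (\<Sum>i=1..d. x i). g (x(Suc d := k)))
      = (\<Sum>(x, k)\<in>Sigma ?B (\<lambda>x. {..N - (\<Sum>i=1..d. x i)}). g (x(Suc d := k)))"
    by (rule sum.Sigma) (use finite_multi_indices_le in auto)
  also have "\<dots> = (\<Sum>x\<in>{x \<in> multi_indices (Suc d). (\<Sum>i=1..Suc d. x i) \<le> N}. g x)"
  proof (rule sum.reindex_bij_witness[where i = "\<lambda>x. (x(Suc d := 0), x (Suc d))"
        and j = "\<lambda>(x, k). x(Suc d := k)"], goal_cases)
    case (2 a)
    then show ?case
      by (auto simp: multi_indices_def upd[simplified])
  next
    case (4 b)
    then show ?case
      by (auto simp: multi_indices_def upd[simplified])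
  qed (use zero in auto)
  finally show ?thesis ..
qed

text \<open>
  The norm is written with the ratio of consecutive values of \<open>1 - p\<^sub>1 - \<dots> - p\<^sub>j\<close>, each to the power
  \<open>\<nu> j\<close>, so that the factor for \<open>j\<close> does not depend on \<open>\<nu> (j + 1)\<close> and the induction on \<open>d\<close> adds
  one factor at a time. No bound on \<open>\<mu>\<close> or \<open>\<nu>\<close> is assumed: the sum vanishes when \<open>|\<nu>| > N\<close>.
\<close>

lemma krawtchouk_prod_orthogonal:
  fixes p :: "nat \<Rightarrow> real" and N :: nat
  assumes "\<And>i. i \<in> {1..d} \<Longrightarrow> 0 < p i" "(\<Sum>i=1..d. p i) < 1"
  shows "(\<Sum>x\<in>{x \<in> multi_indices d. (\<Sum>i=1..d. x i) \<le> N}.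
            krawtchouk_prod d \<nu> p N (\<lambda>i. real (x i)) * krawtchouk_prod d \<mu> p N (\<lambda>i. real (x i)) *
            ((\<Prod>i=1..d. p i ^ x i / fact (x i)) *
             ((1 - (\<Sum>i=1..d. p i)) ^ (N - (\<Sum>i=1..d. x i)) / fact (N - (\<Sum>i=1..d. x i)))))
       = (if (\<forall>i\<in>{1..d}. \<nu> i = \<mu> i) \<and> (\<Sum>i=1..d. \<nu> i) \<le> N
          then (\<Prod>j=1..d. fact (\<nu> j) * p j ^ \<nu> j *
                  ((1 - (\<Sum>i=1..<j. p i)) / (1 - (\<Sum>i=1..j. p i))) ^ \<nu> j)
                / fact (N - (\<Sum>i=1..d. \<nu> i))
          else 0)"
  using assms
proof (induction d arbitrary: N)
  case 0
  have "{x \<in> multi_indices 0. (\<Sum>i=1..0. x i) \<le> N} = {\<lambda>_. 0}"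
    by (auto simp: multi_indices_def)
  then show ?case by (simp add: krawtchouk_prod_0)
next
  case (Suc d)
  define n where "n = \<nu> (Suc d)"
  define m where "m = \<mu> (Suc d)"
  define a where "a = p (Suc d)"
  define b where "b = 1 - (\<Sum>i=1..Suc d. p i)"
  have a: "a > 0" and b: "b > 0" and ab: "1 - (\<Sum>i=1..d. p i) = a + b"
    using Suc.prems by (simp_all add: a_def b_def)
  define F where "F x = krawtchouk_prod d \<nu> p (real N - real n) (\<lambda>i. real (x i))" for x :: "nat \<Rightarrow> nat"
  define G where "G x = krawtchouk_prod d \<mu> p (real N - real m) (\<lambda>i. real (x i))" for x :: "nat \<Rightarrow> nat"
  define W where "W x = (\<Prod>i=1..d. p i ^ x i / fact (x i))" for x :: "nat \<Rightarrow> nat"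
  define S where "S x = (\<Sum>i=1..d. x i)" for x :: "nat \<Rightarrow> nat"
  define E where "E = fact n * a ^ n * ((a + b) / b) ^ n"
  define g where "g x = krawtchouk_prod (Suc d) \<nu> p N (\<lambda>i. real (x i)) *
      krawtchouk_prod (Suc d) \<mu> p N (\<lambda>i. real (x i)) *
      ((\<Prod>i=1..Suc d. p i ^ x i / fact (x i)) *
       (b ^ (N - (\<Sum>i=1..Suc d. x i)) / fact (N - (\<Sum>i=1..Suc d. x i))))" for x :: "nat \<Rightarrow> nat"
  \<comment> \<open>The sum over the last coordinate is a one-variable inner product with \<open>N - S x\<close> balls.\<close>
  have fiber: "(\<Sum>k\<le>N - S x. g (x(Suc d := k)))
      = (if n = m \<and> n \<le> N - S x
         then F x * G x * (W x * ((a + b) ^ (N - S x - n) / fact (N - S x - n))) * E else 0)"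
    if x: "S x \<le> N" for x
  proof -
    have S: "(\<Sum>i=1..d. (x(Suc d := k)) i) = S x" for k
      unfolding S_def by (intro sum.cong) auto
    have S': "(\<Sum>i=1..d. real ((x(Suc d := k)) i)) = real (S x)" for k
      unfolding S_def of_nat_sum by (intro sum.cong) auto
    have W: "(\<Prod>i=1..d. p i ^ (x(Suc d := k)) i / fact ((x(Suc d := k)) i)) = W x" for k
      unfolding W_def by (intro prod.cong) auto
    have F: "krawtchouk_prod d \<nu> p (real N - real n) (\<lambda>i. real ((x(Suc d := k)) i)) = F x" for k
      unfolding F_def by (rule krawtchouk_prod_cong) auto
    have G: "krawtchouk_prod d \<mu> p (real N - real m) (\<lambda>i. real ((x(Suc d := k)) i)) = G x" for k
      unfolding G_def by (rule krawtchouk_prod_cong) auto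
    have M: "real N - real (S x) = real (N - S x)" using x by simp
    have "g (x(Suc d := k)) = F x * G x * W x * (a / b) ^ n * (a / b) ^ m *
        (a ^ k / fact k * (b ^ (N - S x - k) / fact (N - S x - k))
          * krawtchouk_mult n k (a / (a + b)) (N - S x) * krawtchouk_mult m k (a / (a + b)) (N - S x))" for k
      unfolding g_def krawtchouk_prod_Suc n_def[symmetric] m_def[symmetric]
        F G S' ab a_def[symmetric] b_def[symmetric] M prod.cl_ivl_Suc W
      using S[of k] by (simp add: a_def[symmetric] mult_ac)
    then have "(\<Sum>k\<le>N - S x. g (x(Suc d := k))) = F x * G x * W x * (a / b) ^ n * (a / b) ^ m *
        binomial_inner (N - S x) a b (\<lambda>k. krawtchouk_mult n k (a / (a + b)) (N - S x))
          (\<lambda>k. krawtchouk_mult m k (a / (a + b)) (N - S x))"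
      unfolding binomial_inner_def sum_distrib_left by simp
    moreover have "(a / b) ^ n * (a / b) ^ n * (b * (a + b) / a) ^ n = a ^ n * ((a + b) / b) ^ n"
    proof -
      have "a / b * (a / b) * (b * (a + b) / a) = a * ((a + b) / b)"
        using a b by (simp add: field_simps)
      then show ?thesis by (simp only: power_mult_distrib[symmetric])
    qed
    ultimately show ?thesis
      unfolding binomial_inner_krawtchouk[OF a b] E_def by (auto simp: mult_ac)
  qed
  have "(\<Sum>x\<in>{x \<in> multi_indices (Suc d). (\<Sum>i=1..Suc d. x i) \<le> N}. g x)
      = (\<Sum>x\<in>{x \<in> multi_indices d. S x \<le> N}. if n = m \<and> n \<le> N - S x
         then F x * G x * (W x * ((a + b) ^ (N - S x - n) / fact (N - S x - n))) * E else 0)"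
    unfolding sum_multi_indices_Suc S_def[symmetric] by (intro sum.cong refl fiber) simp
  also have "\<dots> = (if n = m \<and> n \<le> N then
        (\<Sum>x\<in>{x \<in> multi_indices d. S x \<le> N - n}.
           F x * G x * (W x * ((a + b) ^ (N - n - S x) / fact (N - n - S x)))) * E else 0)"
  proof (cases "n = m \<and> n \<le> N")
    case True
    \<comment> \<open>The points with \<open>S x > N - n\<close> contribute nothing, which leaves the domain for \<open>N - n\<close> balls.\<close>
    have "(\<Sum>x\<in>{x \<in> multi_indices d. S x \<le> N}. if n = m \<and> n \<le> N - S x
         then F x * G x * (W x * ((a + b) ^ (N - S x - n) / fact (N - S x - n))) * E else 0)
       = (\<Sum>x\<in>{x \<in> multi_indices d. S x \<le> N - n}.
           F x * G x * (W x * ((a + b) ^ (N - S x - n) / fact (N - S x - n))) * E)"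
      using True finite_multi_indices_le[of d N, folded S_def]
      by (intro sum.mono_neutral_cong_right) auto
    then show ?thesis using True by (simp add: sum_distrib_right add.commute)
  next
    case False
    then show ?thesis by (auto intro!: sum.neutral)
  qed
  also have "\<dots> = (if n = m \<and> n \<le> N then
      (if (\<forall>i\<in>{1..d}. \<nu> i = \<mu> i) \<and> S \<nu> \<le> N - n
       then (\<Prod>j=1..d. fact (\<nu> j) * p j ^ \<nu> j *
                  ((1 - (\<Sum>i=1..<j. p i)) / (1 - (\<Sum>i=1..j. p i))) ^ \<nu> j) / fact (N - n - S \<nu>)
       else 0) * E else 0)"
  proof (cases "n = m \<and> n \<le> N")
    case True
    then have nm: "m = n" and N: "real N - real n = real (N - n)" by auto
    have "(\<Sum>i=1..d. p i) < 1" using ab a b by simp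
    then show ?thesis
      using True Suc.IH[of "N - n"] Suc.prems(1)
      unfolding F_def G_def nm N W_def S_def ab by simp
  qed auto
  also have "\<dots> = (if (\<forall>i\<in>{1..Suc d}. \<nu> i = \<mu> i) \<and> (\<Sum>i=1..Suc d. \<nu> i) \<le> N
          then (\<Prod>j=1..Suc d. fact (\<nu> j) * p j ^ \<nu> j *
                  ((1 - (\<Sum>i=1..<j. p i)) / (1 - (\<Sum>i=1..j. p i))) ^ \<nu> j)
                / fact (N - (\<Sum>i=1..Suc d. \<nu> i))
          else 0)"
  proof -
    have all: "(\<forall>i\<in>{1..Suc d}. \<nu> i = \<mu> i) \<longleftrightarrow> (\<forall>i\<in>{1..d}. \<nu> i = \<mu> i) \<and> n = m"
      by (auto simp: n_def m_def le_Suc_eq)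
    have tot: "(\<Sum>i=1..Suc d. \<nu> i) = S \<nu> + n" by (simp add: S_def n_def)
    have E: "E = fact (\<nu> (Suc d)) * p (Suc d) ^ \<nu> (Suc d) *
        ((1 - (\<Sum>i=1..<Suc d. p i)) / (1 - (\<Sum>i=1..Suc d. p i))) ^ \<nu> (Suc d)"
      unfolding E_def a_def[symmetric] n_def[symmetric] b_def[symmetric]
        atLeastLessThanSuc_atLeastAtMost ab ..
    have "S \<nu> + n \<le> N \<longleftrightarrow> n \<le> N \<and> S \<nu> \<le> N - n" by auto
    moreover have "N - (S \<nu> + n) = N - n - S \<nu>" by simp
    ultimately show ?thesis
      unfolding all tot prod.cl_ivl_Suc E[symmetric] by auto
  qed
  finally show ?case unfolding g_def b_def .
qed

section \<open>Normalisation and the theorem\<close>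

text \<open>
  Collecting equal bases in a product of powers of ratios. It is used with
  \<open>s j = 1 - p\<^sub>1 - \<dots> - p\<^sub>j\<close> and \<open>\<nu> (d + 1) = 0\<close>.
\<close>

lemma prod_power_int_diff:
  fixes s :: "nat \<Rightarrow> real" and \<nu> :: "nat \<Rightarrow> nat"
  assumes "s 0 = 1" "\<And>j. j \<in> {1..d} \<Longrightarrow> s j \<noteq> 0"
  shows "(\<Prod>j=1..d. 1 / s j powi (int (\<nu> j) - int (\<nu> (j+1))))
       = (\<Prod>j=1..d. (s (j - 1) / s j) ^ \<nu> j) * s d ^ \<nu> (d+1)"
  using assms(2)
proof (induction d)
  case 0
  then show ?case by (simp add: assms(1))
next
  case (Suc d)
  have IH: "(\<Prod>j=1..d. 1 / s j powi (int (\<nu> j) - int (\<nu> (j+1))))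
       = (\<Prod>j=1..d. (s (j - 1) / s j) ^ \<nu> j) * s d ^ \<nu> (d+1)"
    using Suc by simp
  have "s (Suc d) \<noteq> 0" using Suc.prems by simp
  then have step: "s d ^ \<nu> (Suc d) * (1 / s (Suc d) powi (int (\<nu> (Suc d)) - int (\<nu> (Suc d + 1))))
     = (s d / s (Suc d)) ^ \<nu> (Suc d) * s (Suc d) ^ \<nu> (Suc d + 1)"
    by (simp add: power_int_diff power_divide)
  show ?case
    using arg_cong[OF step, of "(*) (\<Prod>j=1..d. (s (j - 1) / s j) ^ \<nu> j)"]
    unfolding prod.cl_ivl_Suc IH by (simp add: mult_ac)
qed

lemma minus_one_power_div_pochhammer:
  assumes "s \<le> N"
  shows "(- 1) ^ s / pochhammer (- real N) s = fact (N - s) / fact N"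
proof -
  have "(- 1) ^ s * pochhammer (- real N) s / fact s = real (N choose s)"
    by (simp add: binomial_gbinomial gbinomial_pochhammer)
  also have "\<dots> = fact N / (fact s * fact (N - s))"
    using assms by (rule binomial_fact)
  finally have "pochhammer (- real N) s = (- 1) ^ s * (fact N / fact (N - s))"
    by (cases "even s") (auto simp: field_simps)
  then show ?thesis by (cases "even s") auto
qed

lemma multi_krawtchouk_eq:
  "multi_krawtchouk d \<nu> p N x =
     (- 1) ^ (\<Sum>i=1..d. \<nu> i) / pochhammer (- real N) (\<Sum>i=1..d. \<nu> i) * krawtchouk_prod d \<nu> p N x"
  unfolding multi_krawtchouk_def krawtchouk_prod_def ..

theorem theorem6p2:
  fixes d N :: nat and p :: "nat \<Rightarrow> real"
  assumes "d > 1"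
    and "\<And>i. i \<in> {1..d} \<Longrightarrow> 0 < p i \<and> p i < 1"
    and "(\<Sum>i=1..d. p i) < 1"
  shows "(\<forall>\<nu> \<in> multi_indices d. (\<Sum>i=1..d. \<nu> i) \<le> N \<longrightarrow>
           (\<forall>x :: nat \<Rightarrow> real.
              krawtchouk_operator d p N (multi_krawtchouk d \<nu> p N) x =
              - real (\<Sum>i=1..d. \<nu> i) * multi_krawtchouk d \<nu> p N x)) \<and>
         (\<forall>\<nu> \<in> multi_indices d. \<forall>\<mu> \<in> multi_indices d.
           (\<Sum>i=1..d. \<nu> i) \<le> N \<longrightarrow> (\<Sum>i=1..d. \<mu> i) \<le> N \<longrightarrow>
           (\<Sum>x \<in> {x \<in> multi_indices d. (\<Sum>i=1..d. x i) \<le> N}.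
              multi_krawtchouk d \<nu> p N (\<lambda>i. real (x i)) *
              multi_krawtchouk d \<mu> p N (\<lambda>i. real (x i)) *
              (\<Prod>i=1..d+1. (p(d+1 := 1 - (\<Sum>l=1..d. p l))) i ^ (x(d+1 := N - (\<Sum>l=1..d. x l))) i
                          / fact ((x(d+1 := N - (\<Sum>l=1..d. x l))) i))) =
           (- 1) ^ (\<Sum>i=1..d. \<nu> i) / (pochhammer (- real N) (\<Sum>i=1..d. \<nu> i) * fact N) *
           (\<Prod>j=1..d. fact (\<nu> j) * p j ^ \<nu> j
                      / (1 - (\<Sum>i=1..j. p i)) powi (int (\<nu> j) - int (\<nu> (j+1)))) *
           (if \<nu> = \<mu> then 1 else 0))"
proof -
  have pos: "0 < p i" if "i \<in> {1..d}" for i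
    using assms(2)[OF that] by simp
  have partial: "(\<Sum>i=1..j. p i) < 1" if "j \<le> d" for j
  proof -
    have "(\<Sum>i=1..j. p i) \<le> (\<Sum>i=1..d. p i)"
      using that pos by (intro sum_mono2) (auto intro!: less_imp_le)
    then show ?thesis using assms(3) by simp
  qed
  define C where "C \<nu> = (- 1) ^ (\<Sum>i=1..d. \<nu> i) / pochhammer (- real N) (\<Sum>i=1..d. \<nu> i)" for \<nu> :: "nat \<Rightarrow> nat"
  have mk: "multi_krawtchouk d \<nu> p N x = C \<nu> * krawtchouk_prod d \<nu> p N x" for \<nu> x
    unfolding multi_krawtchouk_eq C_def ..
  have difference: "krawtchouk_operator d p N (multi_krawtchouk d \<nu> p N) x
      = - real (\<Sum>i=1..d. \<nu> i) * multi_krawtchouk d \<nu> p N x" for \<nu> x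
  proof -
    have "krawtchouk_operator d p N (krawtchouk_prod d \<nu> p N) x
        = - real (\<Sum>i=1..d. \<nu> i) * krawtchouk_prod d \<nu> p N x"
      by (rule krawtchouk_operator_prod) (use pos partial in \<open>fastforce dest: less_imp_le\<close>)+
    then show ?thesis
      unfolding mk[abs_def] krawtchouk_operator_scale by simp
  qed
  have weight: "(\<Prod>i=1..d+1. (p(d+1 := 1 - (\<Sum>l=1..d. p l))) i ^ (x(d+1 := N - (\<Sum>l=1..d. x l))) i
                          / fact ((x(d+1 := N - (\<Sum>l=1..d. x l))) i))
      = (\<Prod>i=1..d. p i ^ x i / fact (x i)) *
         ((1 - (\<Sum>i=1..d. p i)) ^ (N - (\<Sum>i=1..d. x i)) / fact (N - (\<Sum>i=1..d. x i)))" for x :: "nat \<Rightarrow> nat"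
  proof -
    have "(\<Prod>i=1..d. (p(d+1 := 1 - (\<Sum>l=1..d. p l))) i ^ (x(d+1 := N - (\<Sum>l=1..d. x l))) i
                          / fact ((x(d+1 := N - (\<Sum>l=1..d. x l))) i))
        = (\<Prod>i=1..d. p i ^ x i / fact (x i))"
      by (intro prod.cong) auto
    then show ?thesis unfolding Suc_eq_plus1[symmetric] prod.cl_ivl_Suc by simp
  qed
  have norm: "(\<Prod>j=1..d. fact (\<nu> j) * p j ^ \<nu> j / (1 - (\<Sum>i=1..j. p i)) powi (int (\<nu> j) - int (\<nu> (j+1))))
      = (\<Prod>j=1..d. fact (\<nu> j) * p j ^ \<nu> j * ((1 - (\<Sum>i=1..<j. p i)) / (1 - (\<Sum>i=1..j. p i))) ^ \<nu> j)"
    if "\<nu> \<in> multi_indices d" for \<nu>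
  proof -
    define s where "s j = 1 - (\<Sum>i=1..j. p i)" for j
    have "s j \<noteq> 0" if "j \<in> {1..d}" for j
      using partial[of j] that by (simp add: s_def)
    moreover have "\<nu> (d+1) = 0" using that by (simp add: multi_indices_def)
    ultimately have tele: "(\<Prod>j=1..d. 1 / s j powi (int (\<nu> j) - int (\<nu> (j+1))))
        = (\<Prod>j=1..d. (s (j - 1) / s j) ^ \<nu> j)"
      using prod_power_int_diff[of s d \<nu>] by (simp add: s_def)
    have prev: "1 - (\<Sum>i=1..<j. p i) = s (j - 1)" if "j \<in> {1..d}" for j
      using that unfolding s_def by (cases j) (auto simp: atLeastLessThanSuc_atLeastAtMost)
    have "(\<Prod>j=1..d. fact (\<nu> j) * p j ^ \<nu> j / s j powi (int (\<nu> j) - int (\<nu> (j+1))))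
        = (\<Prod>j=1..d. fact (\<nu> j) * p j ^ \<nu> j) * (\<Prod>j=1..d. 1 / s j powi (int (\<nu> j) - int (\<nu> (j+1))))"
      unfolding prod.distrib[symmetric] by simp
    also have "\<dots> = (\<Prod>j=1..d. fact (\<nu> j) * p j ^ \<nu> j * ((1 - (\<Sum>i=1..<j. p i)) / s j) ^ \<nu> j)"
      unfolding tele prod.distrib[symmetric] by (intro prod.cong refl) (simp only: prev)
    finally show ?thesis unfolding s_def .
  qed
  have orthogonal: "(\<Sum>x \<in> {x \<in> multi_indices d. (\<Sum>i=1..d. x i) \<le> N}.
              multi_krawtchouk d \<nu> p N (\<lambda>i. real (x i)) *
              multi_krawtchouk d \<mu> p N (\<lambda>i. real (x i)) *
              (\<Prod>i=1..d+1. (p(d+1 := 1 - (\<Sum>l=1..d. p l))) i ^ (x(d+1 := N - (\<Sum>l=1..d. x l))) i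
                          / fact ((x(d+1 := N - (\<Sum>l=1..d. x l))) i))) =
           (- 1) ^ (\<Sum>i=1..d. \<nu> i) / (pochhammer (- real N) (\<Sum>i=1..d. \<nu> i) * fact N) *
           (\<Prod>j=1..d. fact (\<nu> j) * p j ^ \<nu> j
                      / (1 - (\<Sum>i=1..j. p i)) powi (int (\<nu> j) - int (\<nu> (j+1)))) *
           (if \<nu> = \<mu> then 1 else 0)" (is "?lhs = ?rhs")
    if \<nu>: "\<nu> \<in> multi_indices d" and \<mu>: "\<mu> \<in> multi_indices d" and le: "(\<Sum>i=1..d. \<nu> i) \<le> N" for \<nu> \<mu>
  proof -
    define H where "H = (\<Prod>j=1..d. fact (\<nu> j) * p j ^ \<nu> j *
        ((1 - (\<Sum>i=1..<j. p i)) / (1 - (\<Sum>i=1..j. p i))) ^ \<nu> j)"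
    have same: "(\<forall>i\<in>{1..d}. \<nu> i = \<mu> i) \<longleftrightarrow> \<nu> = \<mu>"
      using \<nu> \<mu> unfolding multi_indices_def fun_eq_iff mem_Collect_eq by metis
    have "?lhs = C \<nu> * C \<mu> * (\<Sum>x \<in> {x \<in> multi_indices d. (\<Sum>i=1..d. x i) \<le> N}.
            krawtchouk_prod d \<nu> p N (\<lambda>i. real (x i)) * krawtchouk_prod d \<mu> p N (\<lambda>i. real (x i)) *
            ((\<Prod>i=1..d. p i ^ x i / fact (x i)) *
             ((1 - (\<Sum>i=1..d. p i)) ^ (N - (\<Sum>i=1..d. x i)) / fact (N - (\<Sum>i=1..d. x i)))))"
      unfolding mk weight sum_distrib_left by (intro sum.cong refl) (simp only: mult_ac)
    also have "\<dots> = C \<nu> * C \<mu> * (if \<nu> = \<mu> then H / fact (N - (\<Sum>i=1..d. \<nu> i)) else 0)"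
      by (subst krawtchouk_prod_orthogonal) (use pos assms(3) le same in \<open>auto simp: H_def\<close>)
    also have "\<dots> = C \<nu> / fact N * H * (if \<nu> = \<mu> then 1 else 0)"
      using minus_one_power_div_pochhammer[OF le] unfolding C_def[of \<nu>, symmetric]
      by (cases "\<nu> = \<mu>") simp_all
    also have "\<dots> = ?rhs"
      unfolding norm[OF \<nu>] C_def H_def by simp
    finally show ?thesis .
  qed
  show ?thesis using difference orthogonal by blast
qed

end
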